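(* Assume the $ABC$ conjecture: for every $\varepsilon>0$ there exists a constant $K_\varepsilon$ such that whenever $A,B,C$ are coprime nonzero integers with $A+B=C$, one has $\max\{|A|,|B|,|C|\}\le K_\varepsilon\,\mathrm{rad}(ABC)^{1+\varepsilon}$. Let $a>1$ be an integer and let $u_n=a^n-1$ for positive integers $n$. Then for any real numbers $K>0$ and $c>1$, the set $$\mathcal{A}_{K,c,\mathbf{u}}=\{n\ge 1:\ s_{Kn}(u_n)>c^n\}$$ is finite.
   Context: For a nonzero integer $m$, $\mathrm{rad}(m)=\prod_{p\mid m}p$ is the product of the distinct primes dividing $m$. For a positive integer $m$, $P(m)$ denotes the largest prime factor of $m$ (with the convention that $1$ satisfies $P(1)\le y$ for every $y$). For a real number $y>0$, $s_y(m)$ denotes the largest divisor $d$ of $m$ with $P(d)\le y$, i.e. the $y$-smooth part of $m$. In the definition of $\mathcal{A}_{K,c,\mathbf{u}}$, $n$ ranges over positive integers. *)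

theory Defs
  imports Complex_Main "HOL-Computational_Algebra.Primes"
begin

definition rad :: "int \<Rightarrow> int" where
  "rad m = \<Prod>(prime_factors m)"

definition abc_conjecture :: bool where
  "abc_conjecture \<longleftrightarrow>
    (\<forall>\<epsilon>::real. \<epsilon> > 0 \<longrightarrow> (\<exists>K::real. \<forall>A B C :: int.
      A \<noteq> 0 \<and> B \<noteq> 0 \<and> C \<noteq> 0 \<and> Gcd {A, B, C} = 1 \<and> A + B = C \<longrightarrow>
        real_of_int (Max {\<bar>A\<bar>, \<bar>B\<bar>, \<bar>C\<bar>}) \<le> K * real_of_int (rad (A * B * C)) powr (1 + \<epsilon>)))"

(* Meant for positive m. The value 0 at m = 1 realises the convention that 1 is
   y-smooth for every real y > 0, including y < 1. *)
definition largest_prime_factor :: "int \<Rightarrow> int" where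
  "largest_prime_factor m = (if m = 1 then 0 else Max (prime_factors m))"

(* Meant for y > 0 and m > 0, where the set is finite and contains 1. *)
definition smooth_part :: "real \<Rightarrow> int \<Rightarrow> int" where
  "smooth_part y m =
    Max {d. d > 0 \<and> d dvd m \<and> real_of_int (largest_prime_factor d) \<le> y}"

definition large_smooth_part_set :: "real \<Rightarrow> real \<Rightarrow> (nat \<Rightarrow> int) \<Rightarrow> nat set" where
  "large_smooth_part_set K c u =
    {n. n \<ge> 1 \<and> real_of_int (smooth_part (K * real n) (u n)) > c ^ n}"

end

theory Submission
  imports Defs "HOL-Number_Theory.Pocklington" "HOL-Real_Asymp.Real_Asymp"
begin

text \<open>
  Let \<open>d\<close> be a divisor of \<open>a^n - 1\<close>. Applied to \<open>1 + (a^n - 1) = a^n\<close>, the ABC conjecture says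
  that the part of \<open>a^n - 1\<close> coming from repeated prime factors is small: up to a constant factor,
  \<open>d / rad d\<close> is at most \<open>a^(\<epsilon> n)\<close> (lemma \<open>abc_imp_ln_divisor_le\<close>). Choosing \<open>\<epsilon>\<close> so that
  \<open>a^\<epsilon>\<close> is the square root of \<open>c\<close>, a smooth part \<open>d > c^n\<close> forces \<open>rad d\<close> to grow exponentially
  in \<open>n\<close>.

  On the other hand \<open>rad d\<close> is a product of distinct primes \<open>p \<le> K n\<close> dividing \<open>a^n - 1\<close>, and there
  are few of those. The multiplicative order \<open>t\<close> of \<open>a\<close> modulo \<open>p\<close> divides both \<open>n\<close> and \<open>p - 1\<close>.
  For a given \<open>t\<close>, the product of these primes divides \<open>a^t - 1\<close>, which is the better information if
  \<open>t \<le> sqrt n\<close>; and they lie in one residue class modulo \<open>t\<close>, so that there are at most \<open>K n / t\<close> of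
  them, which is the better information if \<open>t > sqrt n\<close>. In both cases they contribute
  \<open>O(sqrt n * ln n)\<close> to \<open>ln (rad d)\<close> (lemma \<open>sum_ln_primes_dvd_power_minus_1_le\<close>). The number of
  possible \<open>t\<close> is the number of divisors of \<open>n\<close>, which is \<open>O(n^(1/3))\<close> (lemma
  \<open>card_divisors_cubed_le\<close>). Hence \<open>ln (rad d) = O(n^(5/6) * ln n)\<close>, and this is eventually smaller
  than any positive multiple of \<open>n\<close>.
\<close>

section \<open>The number of divisors\<close>

lemma card_divisors_mult_le:
  fixes m n :: nat
  assumes "m > 0" "n > 0"
  shows "card {d. d dvd m * n} \<le> card {d. d dvd m} * card {d. d dvd n}"
proof -
  have "{d. d dvd m * n} \<subseteq> (\<lambda>(x, y). x * y) ` ({d. d dvd m} \<times> {d. d dvd n})"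
    using division_decomp[of _ m n] by force
  then have "card {d. d dvd m * n} \<le> card ({d. d dvd m} \<times> {d. d dvd n})"
    using assms by (intro surj_card_le) auto
  then show ?thesis
    by (simp add: card_cartesian_product)
qed

lemma card_divisors_prime_power_le:
  fixes p :: nat
  assumes "prime p"
  shows "card {d. d dvd p ^ e} \<le> e + 1"
proof -
  have "{d. d dvd p ^ e} \<subseteq> (\<lambda>i. p ^ i) ` {..e}"
    using assms by (auto simp: divides_primepow_nat)
  then have "card {d. d dvd p ^ e} \<le> card {..e}"
    by (intro surj_card_le) auto
  then show ?thesis
    by simp
qed

lemma Suc_cubed_le_two_power: "(e + 1) ^ 3 \<le> 8 * 2 ^ e" for e :: nat
proof -
  have large: "(e + 1) ^ 3 \<le> 8 * 2 ^ e" if "e \<ge> 3"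
    using that
  proof (induction e rule: dec_induct)
    case base
    then show ?case by simp
  next
    case (step k)
    have "k ^ 2 \<ge> 3 * k" and "k ^ 3 \<ge> 3 * k ^ 2"
      using step.hyps by (simp_all add: power2_eq_square power3_eq_cube)
    then have "k ^ 3 \<ge> 6 * k + 6"
      using step.hyps by linarith
    moreover have "(k + 2) ^ 3 = k ^ 3 + 6 * k ^ 2 + 12 * k + 8"
      and "2 * (k + 1) ^ 3 = 2 * k ^ 3 + 6 * k ^ 2 + 6 * k + 2"
      by (simp_all add: power2_eq_square power3_eq_cube algebra_simps)
    ultimately have "(k + 2) ^ 3 \<le> 2 * (k + 1) ^ 3"
      by linarith
    then show ?case
      using step.IH by simp
  qed
  show ?thesis
  proof (cases "e \<ge> 3")
    case False
    then have "e = 0 \<or> e = 1 \<or> e = 2"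
      by auto
    then show ?thesis
      by (auto simp: power3_eq_cube)
  qed (use large in simp)
qed

lemma Suc_cubed_le_eight_power: "(e + 1) ^ 3 \<le> 8 ^ e" for e :: nat
proof -
  have "e + 1 \<le> 2 ^ e"
    by (simp add: Suc_leI)
  then have "(e + 1) ^ 3 \<le> (2 ^ e) ^ 3"
    by (rule power_mono) simp
  also have "(2 ^ e) ^ 3 = (2 ^ 3 :: nat) ^ e"
    by (metis mult.commute power_mult)
  finally show ?thesis
    by simp
qed

text \<open>
  The exact power \<open>p^e\<close> of a prime in \<open>n\<close> multiplies the number of divisors by \<open>e + 1\<close>, and
  \<open>(e + 1)^3\<close> exceeds \<open>p^e\<close> only for primes \<open>p < 8\<close>, and then by a factor of at most \<open>8\<close>.
\<close>

lemma card_divisors_cubed_le_aux: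
  fixes n :: nat
  assumes "n > 0"
  shows "card {d. d dvd n} ^ 3 \<le> 8 ^ card {p. prime p \<and> p dvd n \<and> p < 8} * n"
  using assms
proof (induction n rule: less_induct)
  case (less n)
  let ?S = "\<lambda>n. {p::nat. prime p \<and> p dvd n \<and> p < 8}"
  show ?case
  proof (cases "n = 1")
    case True
    then show ?thesis
      by simp
  next
    case False
    then obtain p where p: "prime p" "p dvd n"
      using prime_factor_nat by blast
    obtain m where m: "n = p ^ multiplicity p n * m" "\<not> p dvd m"
      using multiplicity_decompose'[of n p] less.prems p not_prime_unit by (metis less_irrefl)
    define e where "e = multiplicity p n"
    have "e > 0"
      using p less.prems by (auto simp: e_def prime_multiplicity_gt_zero_iff)
    have n: "n = p ^ e * m"
      using m by (simp add: e_def)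
    have "m > 0"
      using n less.prems by (cases m) auto
    have "p ^ e > 1"
      using \<open>e > 0\<close> p prime_gt_1_nat one_less_power by blast
    then have "m < n"
      using n \<open>m > 0\<close> by simp
    have IH: "card {d. d dvd m} ^ 3 \<le> 8 ^ card (?S m) * m"
      using less.IH \<open>m < n\<close> \<open>m > 0\<close> by blast
    have sub: "?S m \<subseteq> ?S n"
      using n by auto
    have fin: "finite (?S k)" for k
      by (rule finite_subset[of _ "{..<8}"]) auto
    have bound: "(e + 1) ^ 3 * 8 ^ card (?S m) \<le> 8 ^ card (?S n) * p ^ e"
    proof (cases "p < 8")
      case True
      then have "card (insert p (?S m)) \<le> card (?S n)"
        using p sub fin by (intro card_mono) auto
      then have "Suc (card (?S m)) \<le> card (?S n)"
        using m fin by simp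
      then have "(8::nat) ^ Suc (card (?S m)) \<le> 8 ^ card (?S n)"
        by (intro power_increasing) auto
      moreover have "(2::nat) ^ e \<le> p ^ e"
        using p prime_ge_2_nat by (intro power_mono) auto
      ultimately have "8 ^ Suc (card (?S m)) * 2 ^ e \<le> 8 ^ card (?S n) * p ^ e"
        by (intro mult_mono) auto
      moreover have "(e + 1) ^ 3 * 8 ^ card (?S m) \<le> 8 * 2 ^ e * 8 ^ card (?S m)"
        by (intro mult_right_mono Suc_cubed_le_two_power) simp
      moreover have "8 * 2 ^ e * 8 ^ card (?S m) = (8::nat) ^ Suc (card (?S m)) * 2 ^ e"
        by simp
      ultimately show ?thesis
        by linarith
    next
      case False
      then have "(8::nat) ^ e \<le> p ^ e"
        by (intro power_mono) auto
      with Suc_cubed_le_eight_power[of e] have "(e + 1) ^ 3 \<le> p ^ e"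
        by linarith
      moreover have "(8::nat) ^ card (?S m) \<le> 8 ^ card (?S n)"
        using sub fin by (intro power_increasing card_mono) auto
      ultimately have "(e + 1) ^ 3 * 8 ^ card (?S m) \<le> p ^ e * 8 ^ card (?S n)"
        by (rule mult_mono) auto
      then show ?thesis
        by (simp only: mult.commute)
    qed
    have "card {d. d dvd n} \<le> card {d. d dvd p ^ e} * card {d. d dvd m}"
      unfolding n using \<open>m > 0\<close> prime_gt_0_nat[OF p(1)] by (intro card_divisors_mult_le) auto
    also have "\<dots> \<le> (e + 1) * card {d. d dvd m}"
      using p by (intro mult_right_mono card_divisors_prime_power_le) auto
    finally have "card {d. d dvd n} ^ 3 \<le> ((e + 1) * card {d. d dvd m}) ^ 3"
      by (rule power_mono) simp
    also have "\<dots> = (e + 1) ^ 3 * card {d. d dvd m} ^ 3"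
      by (rule power_mult_distrib)
    also have "\<dots> \<le> (e + 1) ^ 3 * (8 ^ card (?S m) * m)"
      using IH by (rule mult_left_mono) simp
    also have "\<dots> = ((e + 1) ^ 3 * 8 ^ card (?S m)) * m"
      by (rule mult.assoc[symmetric])
    also have "\<dots> \<le> (8 ^ card (?S n) * p ^ e) * m"
      using bound by (rule mult_right_mono) simp
    also have "\<dots> = 8 ^ card (?S n) * (p ^ e * m)"
      by (rule mult.assoc)
    finally show ?thesis
      by (simp only: n[symmetric])
  qed
qed

lemma card_divisors_cubed_le:
  fixes n :: nat
  assumes "n > 0"
  shows "card {d. d dvd n} ^ 3 \<le> 8 ^ 8 * n"
proof -
  have "card {p. prime p \<and> p dvd n \<and> p < 8} \<le> card {..<8::nat}"
    by (intro card_mono) auto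
  then have "(8::nat) ^ card {p. prime p \<and> p dvd n \<and> p < 8} \<le> 8 ^ 8"
    by (intro power_increasing) auto
  then show ?thesis
    using card_divisors_cubed_le_aux[OF assms] by (meson mult_right_mono order_trans zero_le)
qed

lemma card_divisors_le_powr:
  fixes n :: nat
  assumes "n > 0"
  shows "real (card {d. d dvd n}) \<le> 256 * real n powr (1/3)"
proof -
  have "real (card {d. d dvd n} ^ 3) \<le> real (8 ^ 8 * n)"
    using card_divisors_cubed_le[OF assms] by (simp only: of_nat_le_iff)
  then have "real (card {d. d dvd n}) ^ 3 \<le> 8 ^ 8 * real n"
    by simp
  also have "8 ^ 8 * real n = (256 * real n powr (1/3)) ^ 3"
    using assms by (simp add: power_mult_distrib powr_powr flip: powr_numeral)
  finally show ?thesis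
    by (subst (asm) power_mono_iff) auto
qed

section \<open>Small primes dividing a power minus one\<close>

lemma prod_primes_dvd:
  fixes M :: nat
  assumes "finite Q" "\<And>p. p \<in> Q \<Longrightarrow> prime p \<and> p dvd M"
  shows "\<Prod>Q dvd M"
  using assms
proof (induction Q rule: finite_induct)
  case (insert p Q)
  have "coprime p (\<Prod>Q)"
    using insert by (intro prod_coprime_right) (metis insertCI primes_coprime)
  then show ?case
    using insert by (simp add: divides_mult)
qed simp

lemma sum_ln_prime_divisors_le:
  fixes M :: nat
  assumes "finite Q" "\<And>p. p \<in> Q \<Longrightarrow> prime p \<and> p dvd M" "M > 0"
  shows "(\<Sum>p\<in>Q. ln (real p)) \<le> ln (real M)"
proof -
  have pos: "p > 0" if "p \<in> Q" for p
    using assms(2)[OF that] prime_gt_0_nat by blast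
  then have "\<Prod>Q > 0"
    by (simp add: prod_pos)
  have "(\<Sum>p\<in>Q. ln (real p)) = ln (real (\<Prod>Q))"
    using pos assms(1) by (simp add: ln_prod)
  also have "\<Prod>Q \<le> M"
    using prod_primes_dvd[OF assms(1,2)] assms(3) by (simp add: dvd_imp_le)
  then have "ln (real (\<Prod>Q)) \<le> ln (real M)"
    using \<open>\<Prod>Q > 0\<close> assms(3) by (simp only: ln_le_cancel_iff of_nat_0_less_iff of_nat_le_iff)
  finally show ?thesis .
qed

lemma card_cong_1_le:
  fixes t :: nat and y :: real
  assumes "t > 0" "\<And>p. p \<in> Q \<Longrightarrow> p > 1 \<and> t dvd p - 1 \<and> real p \<le> y" "y \<ge> 0"
  shows "real (card Q) \<le> y / t"
proof -
  let ?N = "nat \<lfloor>y / t\<rfloor>"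
  have "Q \<subseteq> (\<lambda>k. t * k + 1) ` {1..?N}"
  proof
    fix p assume "p \<in> Q"
    then have p: "p > 1" "t dvd p - 1" "real p \<le> y"
      using assms(2) by auto
    then obtain k where k: "p - 1 = t * k"
      by blast
    then have p_eq: "p = t * k + 1"
      using p by simp
    have "k \<ge> 1"
      using k p by (cases k) auto
    moreover have "real t * real k \<le> y"
      using p(3) by (simp add: p_eq)
    then have "real k \<le> y / t"
      using assms(1) by (simp add: field_simps)
    then have "k \<le> ?N"
      by (simp add: le_nat_floor)
    ultimately show "p \<in> (\<lambda>k. t * k + 1) ` {1..?N}"
      using p_eq by auto
  qed
  then have "card Q \<le> card {1..?N}"
    by (intro surj_card_le) auto
  then have "card Q \<le> ?N"
    by simp
  then have "real (card Q) \<le> real ?N"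
    by simp
  also have "\<dots> \<le> y / t"
    using assms by (intro of_nat_floor) auto
  finally show ?thesis .
qed

lemma sum_ln_primes_dvd_power_minus_1_le:
  fixes a n :: nat and y :: real
  assumes "a > 1" "n > 0" "y \<ge> 1" "finite P"
    and P: "\<And>p. p \<in> P \<Longrightarrow> prime p \<and> p dvd a ^ n - 1 \<and> real p \<le> y"
  shows "(\<Sum>p\<in>P. ln (real p)) \<le>
    real (card {d. d dvd n}) * (sqrt n * ln a + y / sqrt n * ln y)"
proof -
  let ?B = "sqrt n * ln a + y / sqrt n * ln y"
  let ?Q = "\<lambda>t. {p \<in> P. ord p a = t}"
  have dvd_iff: "p dvd a ^ k - 1 \<longleftrightarrow> ord p a dvd k" for p k
  proof -
    have "p dvd a ^ k - 1 \<longleftrightarrow> [a ^ k = 1] (mod p)"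
      using assms(1) by (metis One_nat_def Suc_leI cong_altdef_nat less_trans zero_less_one zero_less_power)
    then show ?thesis
      by (simp only: ord_divides)
  qed
  have dvd: "ord p a dvd n" and ord_dvd: "ord p a dvd p - 1" if "p \<in> P" for p
  proof -
    have p: "prime p" "p dvd a ^ n - 1"
      using P that by auto
    show "ord p a dvd n"
      using p dvd_iff by blast
    \<comment> \<open>The order is \<open>0\<close> exactly when \<open>p\<close> and \<open>a\<close> are not coprime.\<close>
    then have "ord p a \<noteq> 0"
      using assms(2) by (metis dvd_0_left_iff less_irrefl)
    then have "coprime p a"
      by (simp add: ord_eq_0)
    then show "ord p a dvd p - 1"
      using order_divides_totient[of p a] p by (simp add: totient_prime)
  qed
  have "(\<Sum>p\<in>P. ln (real p)) = (\<Sum>t\<in>{t. t dvd n}. \<Sum>p\<in>?Q t. ln (real p))"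
    using assms dvd by (subst sum.group) auto
  also have "\<dots> \<le> (\<Sum>t\<in>{t. t dvd n}. ?B)"
  proof (rule sum_mono)
    fix t assume "t \<in> {t. t dvd n}"
    then have "t > 0"
      using assms(2) by (auto intro: Nat.gr0I)
    show "(\<Sum>p\<in>?Q t. ln (real p)) \<le> ?B"
    proof (cases "real t \<le> sqrt n")
      case True
      have "a ^ t > 1"
        using assms(1) \<open>t > 0\<close> one_less_power by blast
      have "(\<Sum>p\<in>?Q t. ln (real p)) \<le> ln (real (a ^ t - 1))"
        using assms(4) P dvd_iff \<open>a ^ t > 1\<close> by (intro sum_ln_prime_divisors_le) auto
      also have "\<dots> \<le> ln (real (a ^ t))"
        using \<open>a ^ t > 1\<close> assms(1) by (intro ln_mono) (simp_all only: of_nat_0_less_iff of_nat_le_iff)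
      also have "\<dots> = t * ln a"
        using assms(1) by (simp add: ln_realpow)
      also have "\<dots> \<le> sqrt n * ln a"
        using True assms(1) by (intro mult_right_mono) auto
      also have "\<dots> \<le> ?B"
        using assms(3) by simp
      finally show ?thesis .
    next
      case False
      have "(\<Sum>p\<in>?Q t. ln (real p)) \<le> (\<Sum>p\<in>?Q t. ln y)"
        using P assms(3) by (intro sum_mono) (auto simp: prime_gt_0_nat)
      also have "\<dots> = real (card (?Q t)) * ln y"
        by simp
      also have "\<dots> \<le> y / sqrt n * ln y"
      proof (rule mult_right_mono)
        have "real (card (?Q t)) \<le> y / t"
          using P ord_dvd prime_gt_1_nat \<open>t > 0\<close> assms(3) by (intro card_cong_1_le) auto
        also have "y / t \<le> y / sqrt n"
          using False \<open>t > 0\<close> assms(2,3) by (intro divide_left_mono mult_pos_pos) auto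
        finally show "real (card (?Q t)) \<le> y / sqrt n" .
      qed (use assms(3) in simp)
      also have "\<dots> \<le> ?B"
        using assms(1) by simp
      finally show ?thesis .
    qed
  qed
  finally show ?thesis
    by simp
qed

section \<open>Radicals and the ABC conjecture\<close>

lemma rad_pos: "rad m > 0"
  unfolding rad_def by (intro prod_pos) (auto dest: in_prime_factors_imp_prime prime_gt_0_int)

lemma rad_mult_le:
  assumes "m \<noteq> 0" "n \<noteq> 0"
  shows "rad (m * n) \<le> rad m * rad n"
proof -
  let ?A = "prime_factors m" and ?B = "prime_factors n"
  have "\<Prod>(?A \<inter> ?B) > 0"
    by (intro prod_pos) (auto dest: in_prime_factors_imp_prime prime_gt_0_int)
  then have "\<Prod>(?A \<inter> ?B) \<ge> 1"
    by simp
  moreover have "\<Prod>(?A \<union> ?B) * \<Prod>(?A \<inter> ?B) = rad m * rad n"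
    unfolding rad_def by (intro prod.union_inter) auto
  moreover have "rad (m * n) = \<Prod>(?A \<union> ?B)"
    using assms by (simp add: rad_def prime_factors_product)
  ultimately show ?thesis
    using rad_pos[of "m * n"] mult_left_mono[of 1 "\<Prod>(?A \<inter> ?B)" "rad (m * n)"] by simp
qed

lemma rad_le:
  assumes "m > 0"
  shows "rad m \<le> m"
proof -
  have "rad m = \<Prod>(prime_factors m)"
    by (simp add: rad_def)
  also have "\<dots> \<le> (\<Prod>p\<in>prime_factors m. p ^ multiplicity p m)"
  proof (intro prod_mono conjI)
    fix p assume p: "p \<in> prime_factors m"
    then have "p > 0" "multiplicity p m > 0"
      by (auto simp: prime_factors_multiplicity dest: prime_gt_0_int)
    then show "0 \<le> p" "p \<le> p ^ multiplicity p m"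
      by (auto intro: self_le_power)
  qed
  also have "\<dots> = m"
    using assms prime_factorization_int by simp
  finally show ?thesis .
qed

text \<open>
  The logarithmic form of \<open>d \<le> C * a^(\<epsilon> n) * rad d\<close>. With \<open>a^n - 1 = d * m\<close>, the radical in the ABC
  conjecture is at most \<open>rad d * m * a\<close>, so that \<open>d\<close> enters the upper bound for \<open>a^n\<close> only through
  its radical, whereas \<open>m\<close> is at most \<open>a^n / d\<close>.
\<close>

lemma abc_imp_ln_divisor_le:
  fixes a :: int and \<epsilon> :: real
  assumes abc_conjecture "a > 1" "\<epsilon> > 0"
  obtains C :: real where
    "\<And>n d. n > 0 \<Longrightarrow> d > 0 \<Longrightarrow> d dvd a ^ n - 1 \<Longrightarrow>
      ln (real_of_int d) \<le> C + \<epsilon> * real n * ln (real_of_int a) + ln (real_of_int (rad d))"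
proof -
  obtain K0 where K0: "\<And>A B C :: int. A \<noteq> 0 \<and> B \<noteq> 0 \<and> C \<noteq> 0 \<and> Gcd {A, B, C} = 1 \<and> A + B = C \<Longrightarrow>
        real_of_int (Max {\<bar>A\<bar>, \<bar>B\<bar>, \<bar>C\<bar>}) \<le> K0 * real_of_int (rad (A * B * C)) powr (1 + \<epsilon>)"
    using assms(1,3) unfolding abc_conjecture_def by blast
  \<comment> \<open>The constant in the conjecture is an arbitrary real; taking logarithms needs it positive.\<close>
  define K1 where "K1 = max K0 1"
  have K1: "K1 \<ge> K0" "K1 \<ge> 1"
    by (auto simp: K1_def)
  define L where "L = ln (real_of_int a)"
  have "L > 0"
    using assms(2) by (simp add: L_def)
  show ?thesis
  proof (rule that)
    fix n :: nat and d :: int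
    assume "n > 0" "d > 0" "d dvd a ^ n - 1"
    then obtain m where m: "a ^ n - 1 = d * m"
      by blast
    have "a ^ n > 1"
      using assms(2) \<open>n > 0\<close> one_less_power by blast
    then have "d * m > 0"
      using m by simp
    then have "m > 0"
      using \<open>d > 0\<close> by (simp add: zero_less_mult_iff)
    define R where "R = rad d * m * a"
    have "rad (1 * (a ^ n - 1) * a ^ n) \<le> rad (d * m) * rad (a ^ n)"
      using m \<open>a ^ n > 1\<close> \<open>d > 0\<close> \<open>m > 0\<close> assms(2) rad_mult_le[of "d * m" "a ^ n"] by simp
    also have "rad (a ^ n) = rad a"
      using \<open>n > 0\<close> by (simp add: rad_def prime_factors_power)
    also have "rad (d * m) * rad a \<le> R"
    proof -
      have "rad (d * m) \<le> rad d * rad m"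
        using \<open>d > 0\<close> \<open>m > 0\<close> by (intro rad_mult_le) auto
      also have "\<dots> \<le> rad d * m"
        using \<open>m > 0\<close> rad_pos[of d] by (intro mult_left_mono rad_le) auto
      finally show ?thesis
        unfolding R_def using rad_le[of a] rad_pos[of a] rad_pos[of d] \<open>m > 0\<close> assms(2)
        by (intro mult_mono) auto
    qed
    finally have rad_le_R: "rad (1 * (a ^ n - 1) * a ^ n) \<le> R" .
    have "R > 0"
      using rad_pos[of d] \<open>m > 0\<close> assms(2) by (simp add: R_def)
    have "a ^ n \<le> Max {\<bar>1\<bar>, \<bar>a ^ n - 1\<bar>, \<bar>a ^ n\<bar>}"
      using \<open>a ^ n > 1\<close> by simp
    then have "real_of_int (a ^ n) \<le> real_of_int (Max {\<bar>1\<bar>, \<bar>a ^ n - 1\<bar>, \<bar>a ^ n\<bar>})"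
      by (simp only: of_int_le_iff)
    also have "\<dots> \<le> K0 * real_of_int (rad (1 * (a ^ n - 1) * a ^ n)) powr (1 + \<epsilon>)"
      using \<open>a ^ n > 1\<close> assms(2) by (intro K0) auto
    also have "\<dots> \<le> K1 * real_of_int R powr (1 + \<epsilon>)"
      using K1 rad_le_R rad_pos[of "1 * (a ^ n - 1) * a ^ n"] assms(3)
      by (intro mult_mono powr_mono2) (auto simp: less_imp_le)
    finally have "ln (real_of_int (a ^ n)) \<le> ln (K1 * real_of_int R powr (1 + \<epsilon>))"
      using \<open>a ^ n > 1\<close> assms(2) by (simp add: ln_mono)
    also have "\<dots> = ln K1 + (1 + \<epsilon>) * ln (real_of_int R)"
      using K1 \<open>R > 0\<close> by (simp add: ln_mult ln_powr)
    also have "ln (real_of_int R) = ln (real_of_int (rad d)) + ln (real_of_int m) + L"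
      using rad_pos[of d] \<open>m > 0\<close> assms(2) by (simp add: R_def L_def ln_mult)
    finally have ineq: "n * L \<le>
        ln K1 + (1 + \<epsilon>) * (ln (real_of_int (rad d)) + ln (real_of_int m) + L)"
      using assms(2) by (simp add: L_def ln_realpow)
    have "ln (real_of_int d) + ln (real_of_int m) = ln (real_of_int (a ^ n - 1))"
      unfolding m using \<open>d > 0\<close> \<open>m > 0\<close> by (simp add: ln_mult)
    also have "\<dots> \<le> ln (real_of_int (a ^ n))"
      using \<open>a ^ n > 1\<close> by (intro ln_mono) (simp_all only: of_int_le_iff of_int_0_less_iff)
    also have "\<dots> = n * L"
      using assms(2) by (simp add: L_def ln_realpow)
    finally have "ln (real_of_int m) \<le> n * L - ln (real_of_int d)"
      by simp
    then have "(1 + \<epsilon>) * (ln (real_of_int (rad d)) + ln (real_of_int m) + L) \<le>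
        (1 + \<epsilon>) * (ln (real_of_int (rad d)) + (n * L - ln (real_of_int d)) + L)"
      using assms(3) by (intro mult_left_mono) auto
    with ineq have "(1 + \<epsilon>) * ln (real_of_int d) \<le>
        ln K1 + \<epsilon> * n * L + (1 + \<epsilon>) * (L + ln (real_of_int (rad d)))"
      by (simp add: algebra_simps)
    also have "ln K1 + \<epsilon> * n * L \<le> (1 + \<epsilon>) * (ln K1 + \<epsilon> * n * L)"
    proof -
      have "0 \<le> \<epsilon> * (ln K1 + \<epsilon> * n * L)"
        using K1 assms(3) \<open>L > 0\<close> by simp
      then show ?thesis
        by (simp add: distrib_right)
    qed
    also have "(1 + \<epsilon>) * (ln K1 + \<epsilon> * n * L) + (1 + \<epsilon>) * (L + ln (real_of_int (rad d))) =
        (1 + \<epsilon>) * (ln K1 + L + \<epsilon> * n * L + ln (real_of_int (rad d)))"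
      by (simp add: algebra_simps)
    finally show "ln (real_of_int d) \<le>
        (ln K1 + L) + \<epsilon> * real n * ln (real_of_int a) + ln (real_of_int (rad d))"
      using assms(3) by (simp add: L_def)
  qed
qed

section \<open>Smooth parts\<close>

lemma smooth_part_properties:
  fixes y :: real and m :: int
  assumes "y > 0" "m > 0"
  shows "smooth_part y m > 0" "smooth_part y m dvd m"
    and "\<And>p. p \<in> prime_factors (smooth_part y m) \<Longrightarrow> real_of_int p \<le> y"
proof -
  let ?D = "{d. d > 0 \<and> d dvd m \<and> real_of_int (largest_prime_factor d) \<le> y}"
  have "?D \<subseteq> {0..m}"
    using assms(2) by (auto simp: zdvd_imp_le)
  then have "finite ?D"
    using finite_subset by blast
  moreover have "1 \<in> ?D"
    using assms by (simp add: largest_prime_factor_def)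
  ultimately have D: "smooth_part y m \<in> ?D"
    unfolding smooth_part_def by (intro Max_in) blast+
  then show "smooth_part y m > 0" "smooth_part y m dvd m"
    by auto
  fix p assume p: "p \<in> prime_factors (smooth_part y m)"
  then have "smooth_part y m \<noteq> 1"
    by auto
  then have "p \<le> largest_prime_factor (smooth_part y m)"
    using p by (simp add: largest_prime_factor_def)
  then have "real_of_int p \<le> real_of_int (largest_prime_factor (smooth_part y m))"
    by simp
  then show "real_of_int p \<le> y"
    using D by auto
qed

lemma ln_rad_smooth_part_le:
  fixes a :: int and y :: real
  assumes "a > 1" "n > 0" "y \<ge> 1"
  shows "ln (real_of_int (rad (smooth_part y (a ^ n - 1)))) \<le>
    256 * real n powr (1/3) * (sqrt n * ln (real_of_int a) + y / sqrt n * ln y)"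
proof -
  define d where "d = smooth_part y (a ^ n - 1)"
  let ?F = "prime_factors d"
  have "a ^ n > 1"
    using assms one_less_power by blast
  then have d: "d dvd a ^ n - 1" "\<And>p. p \<in> ?F \<Longrightarrow> real_of_int p \<le> y"
    using smooth_part_properties[of y "a ^ n - 1"] assms(3) by (auto simp: d_def)
  have prime: "prime p" "p > 0" if "p \<in> ?F" for p
    using that in_prime_factors_imp_prime prime_gt_0_int by blast+
  have inj: "inj_on nat ?F"
    using prime(2) by (auto intro!: inj_onI simp: eq_nat_nat_iff less_imp_le)
  have "ln (real_of_int (rad d)) = ln (\<Prod>p\<in>?F. real_of_int p)"
    by (simp add: rad_def)
  also have "\<dots> = (\<Sum>p\<in>?F. ln (real_of_int p))"
    by (rule ln_prod) (use prime(2) in fastforce)+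
  also have "\<dots> = (\<Sum>p\<in>?F. ln (real (nat p)))"
    using prime(2) by (intro sum.cong refl) (simp add: less_imp_le)
  also have "\<dots> = (\<Sum>p\<in>nat ` ?F. ln (real p))"
    by (simp add: sum.reindex[OF inj])
  also have "\<dots> \<le> real (card {d. d dvd n}) * (sqrt n * ln (nat a) + y / sqrt n * ln y)"
  proof (rule sum_ln_primes_dvd_power_minus_1_le)
    fix q assume "q \<in> nat ` ?F"
    then obtain p where p: "p \<in> ?F" "q = nat p"
      by blast
    have "p dvd a ^ n - 1"
      using p d(1) in_prime_factors_imp_dvd dvd_trans by blast
    moreover have "int (nat a ^ n - 1) = a ^ n - 1"
      using \<open>a ^ n > 1\<close> assms(1) by (simp add: of_nat_diff)
    ultimately have "int q dvd int (nat a ^ n - 1)"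
      using p prime(2)[OF p(1)] by simp
    then have "q dvd nat a ^ n - 1"
      by (simp only: of_nat_dvd_iff)
    then show "prime q \<and> q dvd nat a ^ n - 1 \<and> real q \<le> y"
      using p prime[OF p(1)] d(2)[OF p(1)] by (simp add: less_imp_le)
  qed (use assms in auto)
  also have "\<dots> \<le> 256 * real n powr (1/3) * (sqrt n * ln (nat a) + y / sqrt n * ln y)"
    using assms by (intro mult_right_mono card_divisors_le_powr) auto
  finally show ?thesis
    using assms(1) by (simp add: d_def)
qed

theorem theorem1p1:
  fixes a :: int and u :: "nat \<Rightarrow> int" and K c :: real
  assumes abc_conjecture
    and "a > 1"
    and "\<And>n. n \<ge> 1 \<Longrightarrow> u n = a ^ n - 1"
    and "K > 0" and "c > 1"
  shows "finite (large_smooth_part_set K c u)"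
proof -
  define L where "L = ln (real_of_int a)"
  define l where "l = ln c"
  have "L > 0" "l > 0"
    using assms by (simp_all add: L_def l_def)
  \<comment> \<open>With this exponent, \<open>a^(\<epsilon> n)\<close> equals \<open>c^(n/2)\<close>.\<close>
  define \<epsilon> where "\<epsilon> = l / (2 * L)"
  have "\<epsilon> > 0" "\<epsilon> * L = l / 2"
    using \<open>L > 0\<close> \<open>l > 0\<close> by (simp_all add: \<epsilon>_def)
  obtain C where C: "\<And>n d. n > 0 \<Longrightarrow> d > 0 \<Longrightarrow> d dvd a ^ n - 1 \<Longrightarrow>
      ln (real_of_int d) \<le> C + \<epsilon> * real n * L + ln (real_of_int (rad d))"
    using abc_imp_ln_divisor_le[OF assms(1,2) \<open>\<epsilon> > 0\<close>] unfolding L_def by blast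
  have "eventually (\<lambda>n. C + 256 * real n powr (1/3) *
      (sqrt (real n) * L + K * real n / sqrt (real n) * ln (K * real n)) < l / 2 * real n) sequentially"
    using \<open>L > 0\<close> \<open>l > 0\<close> assms(4) by real_asymp
  moreover have "eventually (\<lambda>n. K * real n \<ge> 1) sequentially"
    using assms(4) by real_asymp
  ultimately have "eventually (\<lambda>n. n \<notin> large_smooth_part_set K c u) sequentially"
    using eventually_gt_at_top[of 0]
  proof eventually_elim
    case (elim n)
    define d where "d = smooth_part (K * real n) (a ^ n - 1)"
    have "a ^ n > 1"
      using assms(2) \<open>n > 0\<close> one_less_power by blast
    then have d: "d > 0" "d dvd a ^ n - 1"
      using smooth_part_properties[of "K * n" "a ^ n - 1"] elim(2) by (auto simp: d_def)
    have "ln (real_of_int d) \<le> C + \<epsilon> * real n * L + ln (real_of_int (rad d))"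
      using C \<open>n > 0\<close> d by blast
    also have "\<epsilon> * real n * L = l / 2 * real n"
      using \<open>\<epsilon> * L = l / 2\<close> by (metis mult.assoc mult.commute)
    also have "ln (real_of_int (rad d)) \<le>
        256 * real n powr (1/3) * (sqrt (real n) * L + K * real n / sqrt (real n) * ln (K * real n))"
      unfolding d_def L_def using assms(2) elim by (intro ln_rad_smooth_part_le) auto
    finally have "ln (real_of_int d) < l / 2 * real n + l / 2 * real n"
      using elim(1) by linarith
    also have "\<dots> = real n * l"
      by simp
    also have "\<dots> = ln (c ^ n)"
      using assms(5) by (simp add: l_def ln_realpow)
    finally have "real_of_int d < c ^ n"
      using d(1) assms(5) by simp
    then show ?case
      using assms(3)[of n] \<open>n > 0\<close> by (simp add: large_smooth_part_set_def d_def)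
  qed
  then show ?thesis
    by (simp add: eventually_cofinite flip: cofinite_eq_sequentially)
qed

end
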